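(* Let $u:\Omega\to X$ be a solution of the measurable variational formulation, i.e. $u$ is measurable and $\mathcal{A}_{c(\omega)}u(\omega)=\mathcal{L}_{c(\omega)}$ in $Y^*$ almost surely. Suppose that there exist $m\in\mathbb{N}$ and functions $C_j,f_j:\Omega\to\mathbb{R}$, $j=1,\dots,m$, such that $C_jf_j\in L^1(\Omega)$ for all $j=1,\dots,m$ and the bound $$\|u(\omega)\|_X^2\le\sum_{j=1}^mC_j(\omega)f_j(\omega)$$ holds almost surely. Then $u$ solves the second-order moment variational formulation, i.e. $u\in L^2(\Omega;X)$ and $\mathcal{A}_{c(\omega)}u(\omega)=\mathcal{L}_{c(\omega)}$ in $Y^*$ almost surely, and $u$ satisfies the stochastic a priori bound $$\|u\|_{L^2(\Omega;X)}^2\le\sum_{j=1}^m\|C_jf_j\|_{L^1(\Omega)}.$$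
   Context: $(\Omega,\mathcal{F},\mathbb{P})$ is a complete probability space; $X$ and $Y$ are separable Banach spaces over $\mathbb{F}\in\{\mathbb{R},\mathbb{C}\}$; $Y^*$ is the dual of $Y$ (functionals being linear, or antilinear throughout in the sesquilinear setting); $B(X,Y^* )$ is the space of bounded linear maps $X\to Y^*$; $\mathcal{C}$ is a topological space. Maps $c:\Omega\to\mathcal{C}$, $\mathcal{A}:\mathcal{C}\to B(X,Y^* )$, $\mathcal{L}:\mathcal{C}\to Y^*$ are given, and $\mathcal{A}_{c(\omega)}:=(\mathcal{A}\circ c)(\omega)$, $\mathcal{L}_{c(\omega)}:=(\mathcal{L}\circ c)(\omega)$. Topological spaces carry their Borel $\sigma$-algebras, "almost surely" means for $\mathbb{P}$-almost every $\omega$, and $L^p(\Omega;V)$ is the Bochner space. *)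

theory Defs
  imports "HOL-Probability.Probability"
begin

text \<open>The scalar field. The library has real normed spaces only, so \<open>\<F> \<in> {\<real>, \<complex>}\<close> is a type
  class whose members embed isometrically into \<open>\<complex>\<close> with image \<open>\<real>\<close> or \<open>\<complex>\<close>.\<close>

class real_or_complex = real_normed_field +
  fixes to_complex :: "'a \<Rightarrow> complex"
  assumes to_complex_add: "to_complex (a + b) = to_complex a + to_complex b"
    and to_complex_mult: "to_complex (a * b) = to_complex a * to_complex b"
    and to_complex_of_real: "to_complex (r *\<^sub>R 1) = complex_of_real r"
    and norm_to_complex: "cmod (to_complex a) = norm a"
    and range_to_complex: "range to_complex = \<real> \<or> range to_complex = UNIV"

instantiation real :: real_or_complex
begin
definition to_complex_real :: "real \<Rightarrow> complex" where "to_complex_real = complex_of_real"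
instance by standard (auto simp: to_complex_real_def Reals_def)
end

instantiation complex :: real_or_complex
begin
definition to_complex_complex :: "complex \<Rightarrow> complex" where "to_complex_complex = id"
instance by standard (auto simp: to_complex_complex_def scaleR_conv_of_real)
end

definition cnjK :: "'k::real_or_complex \<Rightarrow> 'k" where
  "cnjK a = inv to_complex (cnj (to_complex a))"

lemma cnjK_real: "cnjK (x :: real) = x"
  by (simp add: cnjK_def to_complex_real_def inv_f_f[OF inj_of_real])

lemma cnjK_complex: "cnjK (z :: complex) = cnj z"
  by (simp add: cnjK_def to_complex_complex_def inv_id)

text \<open>A normed space over \<open>\<F>\<close>: a real normed space whose real scalar multiplication is the
  restriction of the scalar multiplication by \<open>\<F>\<close>.\<close>

locale normed_space_over = vector_space scl
  for scl :: "'k::real_or_complex \<Rightarrow> 'v::real_normed_vector \<Rightarrow> 'v" +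
  assumes norm_scale: "norm (scl a x) = norm a * norm x"
    and scale_of_real: "scl (of_real r) x = r *\<^sub>R x"

text \<open>The dual of the space with scalar multiplication \<open>scl\<close>: functionals are bounded and
  \<open>\<tau>\<close>-linear, i.e. linear for \<open>\<tau> = id\<close> and antilinear for \<open>\<tau> = cnjK\<close>. The operator norm is that of
  \<open>'y \<Rightarrow>\<^sub>L 'k\<close>, since it does not depend on the scalar field over which the operator is linear.\<close>

definition dual :: "('k \<Rightarrow> 'k) \<Rightarrow> ('k::real_or_complex \<Rightarrow> 'y::real_normed_vector \<Rightarrow> 'y)
    \<Rightarrow> ('y \<Rightarrow>\<^sub>L 'k) set" where
  "dual \<tau> scl = {\<phi>. \<forall>a y. blinfun_apply \<phi> (scl a y) = \<tau> a * blinfun_apply \<phi> y}"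

text \<open>Bounded linear maps from \<open>X\<close> to the dual of \<open>Y\<close>; \<open>\<F>\<close> acts on functionals by
  \<open>(a \<phi>) y = a * \<phi> y\<close>, so these maps are linear also when the functionals are antilinear.\<close>

definition bounded_linear_to_dual :: "('k \<Rightarrow> 'k)
    \<Rightarrow> ('k::real_or_complex \<Rightarrow> 'x::real_normed_vector \<Rightarrow> 'x)
    \<Rightarrow> ('k \<Rightarrow> 'y::real_normed_vector \<Rightarrow> 'y) \<Rightarrow> ('x \<Rightarrow>\<^sub>L ('y \<Rightarrow>\<^sub>L 'k)) set" where
  "bounded_linear_to_dual \<tau> scaleX scaleY =
    {T. (\<forall>x. blinfun_apply T x \<in> dual \<tau> scaleY) \<and>
        (\<forall>a x y. blinfun_apply (blinfun_apply T (scaleX a x)) y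
          = a * blinfun_apply (blinfun_apply T x) y)}"

text \<open>Bochner spaces, with representatives in place of almost-everywhere classes.\<close>

definition strongly_measurable :: "'o measure \<Rightarrow> ('o \<Rightarrow> 'v::real_normed_vector) \<Rightarrow> bool" where
  "strongly_measurable M v \<longleftrightarrow>
    (\<exists>s. (\<forall>n. simple_function M (s n)) \<and> (AE \<omega> in M. (\<lambda>n. s n \<omega>) \<longlonglongrightarrow> v \<omega>))"

definition bochner_Lp :: "real \<Rightarrow> 'o measure \<Rightarrow> ('o \<Rightarrow> 'v::real_normed_vector) set" where
  "bochner_Lp p M = {v. strongly_measurable M v \<and> integrable M (\<lambda>\<omega>. norm (v \<omega>) powr p)}"

definition Lp_norm :: "real \<Rightarrow> 'o measure \<Rightarrow> ('o \<Rightarrow> 'v::real_normed_vector) \<Rightarrow> real" where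
  "Lp_norm p M v = (LINT \<omega>|M. norm (v \<omega>) powr p) powr (1 / p)"

definition measurable_variational_solution ::
  "'o measure \<Rightarrow> ('o \<Rightarrow> 'c) \<Rightarrow> ('c \<Rightarrow> 'x::real_normed_vector \<Rightarrow>\<^sub>L 'z::real_normed_vector)
    \<Rightarrow> ('c \<Rightarrow> 'z) \<Rightarrow> ('o \<Rightarrow> 'x) \<Rightarrow> bool" where
  "measurable_variational_solution M c A L u \<longleftrightarrow>
    u \<in> borel_measurable M \<and> (AE \<omega> in M. blinfun_apply ((A \<circ> c) \<omega>) (u \<omega>) = (L \<circ> c) \<omega>)"

definition second_order_moment_variational_solution ::
  "'o measure \<Rightarrow> ('o \<Rightarrow> 'c) \<Rightarrow> ('c \<Rightarrow> 'x::real_normed_vector \<Rightarrow>\<^sub>L 'z::real_normed_vector)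
    \<Rightarrow> ('c \<Rightarrow> 'z) \<Rightarrow> ('o \<Rightarrow> 'x) \<Rightarrow> bool" where
  "second_order_moment_variational_solution M c A L u \<longleftrightarrow>
    u \<in> bochner_Lp 2 M \<and> (AE \<omega> in M. blinfun_apply ((A \<circ> c) \<omega>) (u \<omega>) = (L \<circ> c) \<omega>)"

end

theory Submission
  imports Defs
begin

text \<open>The assumed bound gives \<open>\<parallel>u\<parallel>\<^sup>2 \<le> (\<Sum>j. \<bar>C j * f j\<bar>)\<close> almost surely, and the right-hand side is
  integrable. Domination shows that \<open>\<parallel>u\<parallel>\<^sup>2\<close> is integrable, and integrating the inequality yields the
  a priori bound. Membership in the Bochner space also requires that the Borel measurable map \<open>u\<close>
  be an almost sure limit of simple functions; this is where the separability of the solution space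
  enters (\<open>strongly_measurable_if_separable\<close>): along a dense sequence \<open>d\<close>, the value \<open>u \<omega>\<close> is
  approximated by a point among \<open>d 0, \<dots>, d n\<close> that is closest to it.\<close>

lemma separable_space_euclidean_dense_sequence:
  assumes "separable_space (euclidean :: 'a::metric_space topology)"
  obtains d :: "nat \<Rightarrow> 'a::metric_space" where "\<And>x e. e > 0 \<Longrightarrow> \<exists>k. dist x (d k) < e"
proof -
  obtain D :: "'a set" where D: "countable D" "closure D = UNIV"
    using assms by (auto simp: separable_space_def)
  have "D \<noteq> {}" using D(2) by auto
  then have "range (from_nat_into D) = D" using D(1) by (simp add: range_from_nat_into)
  moreover have "\<exists>y\<in>D. dist x y < e" if "e > 0" for x :: 'a and e
    using D(2) that closure_approachable[of x D] by (auto simp: dist_commute)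
  ultimately have "\<exists>k. dist x (from_nat_into D k) < e" if "e > 0" for x e
    using that by (metis rangeE)
  then show thesis using that by blast
qed

text \<open>Separability is a hypothesis on the topology of an arbitrary normed space, not a type class, so
  the simple functions are built by hand. The index of a nearest point among \<open>d 0, \<dots>, d n\<close> is a
  measurable function with finitely many values, and the distance of that point to \<open>u \<omega>\<close> tends to \<open>0\<close> because
  \<open>d\<close> is dense. Convergence holds everywhere, not only almost surely.\<close>

lemma strongly_measurable_if_separable:
  fixes u :: "'o \<Rightarrow> 'x::real_normed_vector"
  assumes sep: "separable_space (euclidean :: 'x topology)"
    and u[measurable]: "u \<in> borel_measurable M"
  shows "strongly_measurable M u"
proof -
  obtain d :: "nat \<Rightarrow> 'x" where d: "\<And>x e. e > 0 \<Longrightarrow> \<exists>k. dist x (d k) < e"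
    using separable_space_euclidean_dense_sequence[OF sep] by blast
  define closest where
    "closest n \<omega> i \<longleftrightarrow> i \<le> n \<and> (\<forall>j\<le>n. dist (u \<omega>) (d i) \<le> dist (u \<omega>) (d j))" for n \<omega> i
  define idx where "idx n \<omega> = (LEAST i. closest n \<omega> i)" for n \<omega>
  have "\<exists>i. closest n \<omega> i" for n \<omega>
    using ex_min_if_finite[of "(\<lambda>i. dist (u \<omega>) (d i)) ` {..n}"]
    by (fastforce simp: closest_def not_less)
  then have idx: "closest n \<omega> (idx n \<omega>)" for n \<omega>
    unfolding idx_def by (rule LeastI_ex)
  have [measurable]: "(\<lambda>\<omega>. dist (u \<omega>) (d i)) \<in> borel_measurable M" for i
    by (rule measurable_compose[OF u])
      (intro borel_measurable_continuous_onI continuous_intros)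
  \<comment> \<open>Ties are broken by the least index, which is what makes the choice measurable.\<close>
  have "(\<lambda>\<omega>. idx n \<omega>) \<in> measurable M (count_space UNIV)" for n
    unfolding idx_def closest_def by measurable
  moreover have "finite (idx n ` space M)" for n
    by (rule finite_subset[of _ "{..n}"]) (use idx in \<open>auto simp: closest_def\<close>)
  ultimately have "simple_function M (idx n)" for n
    by (simp add: simple_function_def measurable_sets)
  then have "simple_function M (\<lambda>\<omega>. d (idx n \<omega>))" for n
    by (rule simple_function_compose1)
  moreover have "(\<lambda>n. d (idx n \<omega>)) \<longlonglongrightarrow> u \<omega>" for \<omega>
  proof (rule metric_LIMSEQ_I)
    fix e :: real assume "e > 0"
    then obtain k where "dist (u \<omega>) (d k) < e" using d by blast
    moreover have "dist (u \<omega>) (d (idx n \<omega>)) \<le> dist (u \<omega>) (d k)" if "n \<ge> k" for n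
      using idx[of n \<omega>] that by (auto simp: closest_def)
    ultimately show "\<exists>k. \<forall>n\<ge>k. dist (d (idx n \<omega>)) (u \<omega>) < e"
      by (metis dist_commute order_le_less_trans)
  qed
  ultimately show ?thesis
    unfolding strongly_measurable_def by (intro exI[of _ "\<lambda>n \<omega>. d (idx n \<omega>)"]) auto
qed

lemma Lp_norm_1: "Lp_norm 1 M v = (LINT \<omega>|M. norm (v \<omega>))"
  by (simp add: Lp_norm_def)

lemma Lp_norm_2_power2: "(Lp_norm 2 M v)\<^sup>2 = (LINT \<omega>|M. (norm (v \<omega>))\<^sup>2)"
proof -
  have "0 \<le> (LINT \<omega>|M. (norm (v \<omega>))\<^sup>2)" by simp
  then show ?thesis by (simp add: Lp_norm_def powr_half_sqrt)
qed

theorem theorem2p6: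
  fixes M :: "'o measure"
    and \<tau> :: "'k::real_or_complex \<Rightarrow> 'k"
    and scaleX :: "'k \<Rightarrow> 'x::banach \<Rightarrow> 'x"
    and scaleY :: "'k \<Rightarrow> 'y::banach \<Rightarrow> 'y"
    and c :: "'o \<Rightarrow> 'c::topological_space"
    and A :: "'c \<Rightarrow> 'x \<Rightarrow>\<^sub>L ('y \<Rightarrow>\<^sub>L 'k)"
    and L :: "'c \<Rightarrow> 'y \<Rightarrow>\<^sub>L 'k"
    and u :: "'o \<Rightarrow> 'x"
    and m :: nat
    and C f :: "nat \<Rightarrow> 'o \<Rightarrow> real"
  assumes "prob_space M" and "complete_measure M"
    and "separable_space (euclidean :: 'x topology)"
    and "separable_space (euclidean :: 'y topology)"
    and "normed_space_over scaleX" and "normed_space_over scaleY"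
    and "\<tau> = id \<or> \<tau> = cnjK"
    and "\<And>k. A k \<in> bounded_linear_to_dual \<tau> scaleX scaleY"
    and "\<And>k. L k \<in> dual \<tau> scaleY"
    and "measurable_variational_solution M c A L u"
    and "\<And>j. j \<in> {1..m} \<Longrightarrow> (\<lambda>\<omega>. C j \<omega> * f j \<omega>) \<in> bochner_Lp 1 M"
    and "AE \<omega> in M. (norm (u \<omega>))\<^sup>2 \<le> (\<Sum>j = 1..m. C j \<omega> * f j \<omega>)"
  shows "second_order_moment_variational_solution M c A L u \<and>
    (Lp_norm 2 M u)\<^sup>2 \<le> (\<Sum>j = 1..m. Lp_norm 1 M (\<lambda>\<omega>. C j \<omega> * f j \<omega>))"
proof -
  have u: "u \<in> borel_measurable M"
    and sol: "AE \<omega> in M. blinfun_apply ((A \<circ> c) \<omega>) (u \<omega>) = (L \<circ> c) \<omega>"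
    using assms(10) by (auto simp: measurable_variational_solution_def)
  let ?g = "\<lambda>\<omega>. \<Sum>j = 1..m. \<bar>C j \<omega> * f j \<omega>\<bar>"
  have int_Cf: "integrable M (\<lambda>\<omega>. \<bar>C j \<omega> * f j \<omega>\<bar>)" if "j \<in> {1..m}" for j
    using assms(11)[OF that] by (simp add: bochner_Lp_def)
  then have int_g: "integrable M ?g" by (rule Bochner_Integration.integrable_sum)
  have bound: "AE \<omega> in M. (norm (u \<omega>))\<^sup>2 \<le> ?g \<omega>"
    using assms(12)
  proof eventually_elim
    case (elim \<omega>)
    also have "(\<Sum>j = 1..m. C j \<omega> * f j \<omega>) \<le> ?g \<omega>" by (intro sum_mono abs_ge_self)
    finally show ?case .
  qed
  have meas_u2: "(\<lambda>\<omega>. (norm (u \<omega>))\<^sup>2) \<in> borel_measurable M"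
    using u by measurable
  have int_u2: "integrable M (\<lambda>\<omega>. (norm (u \<omega>))\<^sup>2)"
    by (rule Bochner_Integration.integrable_bound[OF int_g meas_u2]) (use bound in eventually_elim, auto)
  have "u \<in> bochner_Lp 2 M"
    using strongly_measurable_if_separable[OF assms(3) u] int_u2 by (simp add: bochner_Lp_def)
  moreover have "(Lp_norm 2 M u)\<^sup>2 \<le> (\<Sum>j = 1..m. Lp_norm 1 M (\<lambda>\<omega>. C j \<omega> * f j \<omega>))"
  proof -
    have "(Lp_norm 2 M u)\<^sup>2 = (LINT \<omega>|M. (norm (u \<omega>))\<^sup>2)" by (rule Lp_norm_2_power2)
    also have "\<dots> \<le> (LINT \<omega>|M. ?g \<omega>)" by (rule integral_mono_AE[OF int_u2 int_g bound])
    also have "\<dots> = (\<Sum>j = 1..m. LINT \<omega>|M. \<bar>C j \<omega> * f j \<omega>\<bar>)"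
      by (rule Bochner_Integration.integral_sum[OF int_Cf])
    finally show ?thesis by (simp add: Lp_norm_1)
  qed
  ultimately show ?thesis
    using sol by (simp add: second_order_moment_variational_solution_def)
qed

end
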